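(* Let $\mathbb{G}$ be a risk-averse game with incomplete information with ex ante risk preference profile $\mathcal{R}=\{\rho^1,\dots,\rho^I\}$ consisting of law-invariant coherent risk measures and with common prior $P$. For every $\beta\in NE^{ea}_{\mathbb{G}}(\mathcal{R},P)$ there is a set of risk-neutral players, whose ex ante risk preferences are given by $\mathcal{R}_0$, with subjective prior probability distributions $q^i_*\in\Delta(T)$, $i\in\mathcal{I}$, such that $\beta\in NE^{ea}_{\mathbb{G}}(\mathcal{R}_0,\{q^i_*\}_{i\in\mathcal{I}})$.
   Context: Game. $\mathcal{I}=\{1,\dots,I\}$, $I\ge2$, is a finite set of players. Each player $i$ has a non-empty finite set of types $T_i$ and a non-empty finite set of actions $A_i$; $T=\prod_i T_i$, $A=\prod_i A_i$. $\Delta(S)$ is the set of probability measures on a finite set $S$. $\mathcal{F}$ is the $\sigma$-algebra of all subsets of $T$, and $P$ is a fully supported probability measure on $(T,\mathcal{F})$ (the common prior). Player $i$ has a bounded loss function $l^i:T\times A\to\mathbb{R}$; players minimize losses. $\rho^i:\mathcal{L}^\infty(T,\mathcal{F},P)\to\mathbb{R}$ is the ex ante risk preference of player $i$. Strategies. A (mixed/behavioral) strategy of player $i$ is a map $\beta_i:T_i\to\Delta(A_i)$; $\Sigma_i$ is the set of these and $\Sigma=\prod_i\Sigma_i$. $(\beta_i',\beta_{-i})$ is $\beta$ with player $i$'s strategy replaced by $\beta_i'$. Random loss: $L^i_\beta(t)=L^i(t,\beta)=\sum_{a\in A}l^i(t,a)\prod_{j\in\mathcal{I}}\beta_j(a_j|t_j)$.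 Risk measures. $\rho:\mathcal{L}^\infty(T,\mathcal{F},P)\to\mathbb{R}$ is a coherent risk measure if it satisfies: monotonicity ($\rho(L_1)\le\rho(L_2)$ if $L_1\le L_2$ a.s.); convexity ($\rho((1-\alpha)L_1+\alpha L_2)\le(1-\alpha)\rho(L_1)+\alpha\rho(L_2)$, $0\le\alpha\le1$); translation invariance ($\rho(L+c)=\rho(L)+c$, $c\in\mathbb{R}$); positive homogeneity ($\rho(\alpha L)=\alpha\rho(L)$, $\alpha>0$). It is law-invariant if $\rho(L_1)=\rho(L_2)$ whenever $L_1,L_2$ have the same distribution under $P$. Equilibrium sets. $NE^{ea}_{\mathbb{G}}(\mathcal{R},P)$ is the set of risk-averse Nash equilibria: $\beta\in\Sigma$ with $\rho^i(L^i_\beta)\le\rho^i(L^i_{(\beta_i',\beta_{-i})})$ for all $i\in\mathcal{I}$ and $\beta_i'\in\Sigma_i$. $\mathcal{R}_0$ is the degenerate risk preference profile assigning the expectation risk measure to every player. For subjective priors $p_i\in\Delta(T)$, $i\in\mathcal{I}$ (possibly different across players), $NE^{ea}_{\mathbb{G}}(\mathcal{R}_0,\{p_i\}_{i\in\mathcal{I}})$ is the set of $\beta\in\Sigma$ with $\sum_{t\in T}p_i(t)L^i(t,\beta)\le\sum_{t\in T}p_i(t)L^i(t,(\beta_i',\beta_{-i}))$ for all $i\in\mathcal{I}$ and $\beta_i'\in\Sigma_i$. *)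

theory Defs
  imports "HOL-Probability.Probability"
begin

text \<open>
  The type sets and the action sets of the players are finite subsets of common HOL types
  \<open>'t\<close> and \<open>'a\<close>, so they may differ from player to player.
  The prior and the risk preferences are kept apart from the game form.
\<close>

record ('t, 'a) game =
  num_players :: nat
  types :: "nat \<Rightarrow> 't set"
  actions :: "nat \<Rightarrow> 'a set"
  loss :: "nat \<Rightarrow> (nat \<Rightarrow> 't) \<Rightarrow> (nat \<Rightarrow> 'a) \<Rightarrow> real"

definition players :: "('t, 'a) game \<Rightarrow> nat set" where
  "players G = {1..num_players G}"

definition type_profiles :: "('t, 'a) game \<Rightarrow> (nat \<Rightarrow> 't) set" where
  "type_profiles G = PiE (players G) (types G)"

definition action_profiles :: "('t, 'a) game \<Rightarrow> (nat \<Rightarrow> 'a) set" where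
  "action_profiles G = PiE (players G) (actions G)"

definition game_form :: "('t, 'a) game \<Rightarrow> bool" where
  "game_form G \<longleftrightarrow>
     num_players G \<ge> 2 \<and>
     (\<forall>i\<in>players G. finite (types G i) \<and> types G i \<noteq> {} \<and>
        finite (actions G i) \<and> actions G i \<noteq> {} \<and>
        bounded ((\<lambda>(t, a). loss G i t a) ` (type_profiles G \<times> action_profiles G)))"

definition common_prior :: "('t, 'a) game \<Rightarrow> (nat \<Rightarrow> 't) measure \<Rightarrow> bool" where
  "common_prior G P \<longleftrightarrow>
     prob_space P \<and> space P = type_profiles G \<and> sets P = Pow (type_profiles G) \<and>
     (\<forall>t\<in>type_profiles G. measure P {t} > 0)"

definition prob_simplex :: "'s set \<Rightarrow> 's pmf set" where
  "prob_simplex S = {p. set_pmf p \<subseteq> S}"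

definition strategies :: "('t, 'a) game \<Rightarrow> nat \<Rightarrow> ('t \<Rightarrow> 'a pmf) set" where
  "strategies G i = PiE (types G i) (\<lambda>_. prob_simplex (actions G i))"

definition strategy_profiles :: "('t, 'a) game \<Rightarrow> (nat \<Rightarrow> 't \<Rightarrow> 'a pmf) set" where
  "strategy_profiles G = PiE (players G) (strategies G)"

definition random_loss ::
  "('t, 'a) game \<Rightarrow> nat \<Rightarrow> (nat \<Rightarrow> 't \<Rightarrow> 'a pmf) \<Rightarrow> (nat \<Rightarrow> 't) \<Rightarrow> real" where
  "random_loss G i \<beta> t =
     (\<Sum>a\<in>action_profiles G. loss G i t a * (\<Prod>j\<in>players G. pmf (\<beta> j (t j)) (a j)))"

text \<open>
  \<open>L_infinity M\<close> consists of functions, not of equivalence classes. Monotonicity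
  almost everywhere makes a coherent risk measure agree on functions that are equal almost
  everywhere, in particular on functions that differ only outside \<open>space M\<close>.
\<close>

definition L_infinity :: "'s measure \<Rightarrow> ('s \<Rightarrow> real) set" where
  "L_infinity M = {X \<in> borel_measurable M. \<exists>C. AE x in M. \<bar>X x\<bar> \<le> C}"

definition coherent_risk_measure :: "'s measure \<Rightarrow> (('s \<Rightarrow> real) \<Rightarrow> real) \<Rightarrow> bool" where
  "coherent_risk_measure M \<rho> \<longleftrightarrow>
     (\<forall>X\<in>L_infinity M. \<forall>Y\<in>L_infinity M. (AE x in M. X x \<le> Y x) \<longrightarrow> \<rho> X \<le> \<rho> Y) \<and>
     (\<forall>X\<in>L_infinity M. \<forall>Y\<in>L_infinity M. \<forall>\<alpha>::real. 0 \<le> \<alpha> \<and> \<alpha> \<le> 1 \<longrightarrow>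
        \<rho> (\<lambda>x. (1 - \<alpha>) * X x + \<alpha> * Y x) \<le> (1 - \<alpha>) * \<rho> X + \<alpha> * \<rho> Y) \<and>
     (\<forall>X\<in>L_infinity M. \<forall>c::real. \<rho> (\<lambda>x. X x + c) = \<rho> X + c) \<and>
     (\<forall>X\<in>L_infinity M. \<forall>\<alpha>::real. \<alpha> > 0 \<longrightarrow> \<rho> (\<lambda>x. \<alpha> * X x) = \<alpha> * \<rho> X)"

definition law_invariant :: "'s measure \<Rightarrow> (('s \<Rightarrow> real) \<Rightarrow> real) \<Rightarrow> bool" where
  "law_invariant M \<rho> \<longleftrightarrow>
     (\<forall>X\<in>L_infinity M. \<forall>Y\<in>L_infinity M. distr M borel X = distr M borel Y \<longrightarrow> \<rho> X = \<rho> Y)"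

text \<open>
  The prior is not an argument of \<open>NE_ea\<close>: it enters only through the risk measures
  \<open>\<rho> i\<close>, which are functionals on random losses over the prior.
\<close>

definition NE_ea ::
  "('t, 'a) game \<Rightarrow> (nat \<Rightarrow> ((nat \<Rightarrow> 't) \<Rightarrow> real) \<Rightarrow> real) \<Rightarrow> (nat \<Rightarrow> 't \<Rightarrow> 'a pmf) set" where
  "NE_ea G \<rho> =
     {\<beta> \<in> strategy_profiles G. \<forall>i\<in>players G. \<forall>\<beta>'\<in>strategies G i.
        \<rho> i (random_loss G i \<beta>) \<le> \<rho> i (random_loss G i (\<beta>(i := \<beta>')))}"

definition NE_ea_neutral ::
  "('t, 'a) game \<Rightarrow> (nat \<Rightarrow> (nat \<Rightarrow> 't) pmf) \<Rightarrow> (nat \<Rightarrow> 't \<Rightarrow> 'a pmf) set" where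
  "NE_ea_neutral G p =
     {\<beta> \<in> strategy_profiles G. \<forall>i\<in>players G. \<forall>\<beta>'\<in>strategies G i.
        (\<Sum>t\<in>type_profiles G. pmf (p i) t * random_loss G i \<beta> t) \<le>
        (\<Sum>t\<in>type_profiles G. pmf (p i) t * random_loss G i (\<beta>(i := \<beta>')) t)}"

end

theory Submission
  imports Defs
begin

text \<open>
  Fix a player and let \<open>f\<close> be the equilibrium loss. The attainable losses form a convex set \<open>K\<close>,
  and \<open>D = {d. \<rho> d < \<rho> f}\<close> is convex. By monotonicity and minimality of \<open>f\<close>, no
  element of \<open>K - D\<close> is negative at all type profiles, so some probability distribution \<open>q\<close>
  has nonnegative expectation on \<open>K - D\<close>. As \<open>f - \<epsilon> \<in> D\<close> for every \<open>\<epsilon> > 0\<close>, the loss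
  \<open>f\<close> minimizes the \<open>q\<close>-expectation on \<open>K\<close>. The distribution \<open>q\<close> is found by induction
  on the number of type profiles, which reduces its existence to separation in the plane.
\<close>

section \<open>Separation by probability weights on a finite set\<close>

text \<open>Separate \<open>C\<close> from the open negative quadrant. The quadrant is unbounded in
  both coordinates, so the normal \<open>(u, v)\<close> is nonnegative. It has the origin in its
  closure, so the offset \<open>b\<close> is nonnegative. Dividing by \<open>u + v\<close> gives the
  weights.\<close>

lemma convex_meets_no_negative_quadrant:
  fixes C :: "(real \<times> real) set"
  assumes "convex C" and nonneg: "\<And>x y. (x, y) \<in> C \<Longrightarrow> 0 \<le> x \<or> 0 \<le> y"
  shows "\<exists>\<alpha>. 0 \<le> \<alpha> \<and> \<alpha> \<le> 1 \<and> (\<forall>(x, y)\<in>C. 0 \<le> (1 - \<alpha>) * x + \<alpha> * y)"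
proof (cases "C = {}")
  case True
  then show ?thesis by (intro exI[of _ 0]) simp
next
  case False
  let ?N = "{..<0::real} \<times> {..<0::real}"
  have "\<exists>a b. a \<noteq> 0 \<and> (\<forall>z\<in>?N. inner a z \<le> b) \<and> (\<forall>z\<in>C. inner a z \<ge> b)"
    using nonneg False \<open>convex C\<close>
    by (intro separating_hyperplane_sets) (auto intro!: convex_Times simp: not_less dest: nonneg)
  then obtain a b where a: "a \<noteq> 0" "\<forall>z\<in>?N. inner a z \<le> b" "\<forall>z\<in>C. b \<le> inner a z"
    by blast
  obtain u v where uv: "a = (u, v)" by (cases a)
  have N: "u * x + v * y \<le> b" if "x < 0" "y < 0" for x y
    using that a(2) by (auto simp: uv)
  have C: "b \<le> u * x + v * y" if "(x, y) \<in> C" for x y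
    using that a(3) by (auto simp: uv)
  have b: "0 \<le> b"
  proof (rule ccontr)
    assume "\<not> 0 \<le> b"
    \<comment> \<open>A point \<open>(e, e)\<close> of the quadrant so near the origin that
      \<open>u * e + v * e\<close> is at least \<open>b / 2\<close>, which exceeds the negative
      \<open>b\<close>.\<close>
    define e where "e = b / (2 * (\<bar>u\<bar> + \<bar>v\<bar> + 1))"
    have "e < 0"
      using \<open>\<not> 0 \<le> b\<close> by (simp add: e_def divide_neg_pos)
    moreover have "2 * (\<bar>u\<bar> + \<bar>v\<bar> + 1) * e = b"
      by (simp add: e_def)
    moreover have "u * e \<ge> \<bar>u\<bar> * e" "v * e \<ge> \<bar>v\<bar> * e"
      using \<open>e < 0\<close> by (auto intro: mult_right_mono_neg)
    moreover have "\<bar>u\<bar> * e \<le> 0" "\<bar>v\<bar> * e \<le> 0"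
      using \<open>e < 0\<close> by (auto intro: mult_nonneg_nonpos)
    ultimately show False
      using N[of e e] by (simp add: algebra_simps)
  qed
  have "0 \<le> u"
  proof (rule ccontr)
    assume "\<not> 0 \<le> u"
    \<comment> \<open>The first coordinate is negative and makes the left side
      \<open>b + \<bar>v\<bar> + 1 - v\<close>, which is at least \<open>b + 1\<close>.\<close>
    then have "u * ((b + \<bar>v\<bar> + 1) / u) + v * (-1) \<le> b"
      using b by (intro N divide_pos_neg) auto
    then show False using \<open>\<not> 0 \<le> u\<close> by auto
  qed
  have "0 \<le> v"
  proof (rule ccontr)
    assume "\<not> 0 \<le> v"
    then have "u * (-1) + v * ((b + \<bar>u\<bar> + 1) / v) \<le> b"
      using b by (intro N divide_pos_neg) auto
    then show False using \<open>\<not> 0 \<le> v\<close> by auto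
  qed
  have pos: "0 < u + v"
    using uv a(1) \<open>0 \<le> u\<close> \<open>0 \<le> v\<close> by (auto simp: zero_prod_def)
  show ?thesis
  proof (intro exI[of _ "v / (u + v)"] conjI ballI)
    show "0 \<le> v / (u + v)" "v / (u + v) \<le> 1"
      using \<open>0 \<le> u\<close> \<open>0 \<le> v\<close> pos by auto
    fix z assume "z \<in> C"
    obtain x y where z: "z = (x, y)" by (cases z)
    have "(1 - v / (u + v)) * x + v / (u + v) * y = (u * x + v * y) / (u + v)"
    proof -
      have "1 - v / (u + v) = u / (u + v)"
        using pos by (simp add: field_simps)
      then show ?thesis by (simp add: add_divide_distrib)
    qed
    moreover have "0 \<le> u * x + v * y"
      using C \<open>z \<in> C\<close> b z by force
    ultimately show "case z of (x, y) \<Rightarrow> 0 \<le> (1 - v / (u + v)) * x + v / (u + v) * y"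
      using pos z by simp
  qed
qed

text \<open>A Bernoulli draw selects the component, so the mixture is a \<open>pmf\<close> by
  construction; \<alpha> is the weight of the second component, as in the convexity axiom for risk
  measures.\<close>

definition mix_pmf :: "real \<Rightarrow> 's pmf \<Rightarrow> 's pmf \<Rightarrow> 's pmf" where
  "mix_pmf \<alpha> p q = bind_pmf (bernoulli_pmf \<alpha>) (\<lambda>b. if b then q else p)"

lemma pmf_mix_pmf:
  assumes "0 \<le> \<alpha>" "\<alpha> \<le> 1"
  shows "pmf (mix_pmf \<alpha> p q) x = (1 - \<alpha>) * pmf p x + \<alpha> * pmf q x"
  using assms by (simp add: mix_pmf_def pmf_bind)

lemma set_pmf_mix_pmf: "set_pmf (mix_pmf \<alpha> p q) \<subseteq> set_pmf p \<union> set_pmf q"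
  by (auto simp: mix_pmf_def split: if_splits)

text \<open>Induction on \<open>S\<close>. When a point \<open>t\<close> is added, the induction
  hypothesis yields a \<open>q\<close> on \<open>S\<close> for the members of \<open>C\<close> that
  are negative at \<open>t\<close>; separation in the plane then decides how much mass to move from
  \<open>q\<close> to \<open>t\<close>.\<close>

lemma convex_nonneg_expectation:
  fixes C :: "('s \<Rightarrow> real) set"
  assumes "finite S" "S \<noteq> {}"
    and "\<And>c d \<alpha>. c \<in> C \<Longrightarrow> d \<in> C \<Longrightarrow> 0 \<le> \<alpha> \<Longrightarrow> \<alpha> \<le> 1 \<Longrightarrow>
           (\<lambda>s. (1 - \<alpha>) * c s + \<alpha> * d s) \<in> C"
    and "\<And>c. c \<in> C \<Longrightarrow> \<exists>s\<in>S. 0 \<le> c s"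
  shows "\<exists>q. set_pmf q \<subseteq> S \<and> (\<forall>c\<in>C. 0 \<le> (\<Sum>s\<in>S. pmf q s * c s))"
  using assms
proof (induction S arbitrary: C rule: finite_ne_induct)
  case (singleton s)
  then show ?case by (intro exI[of _ "return_pmf s"]) fastforce
next
  case (insert t S)
  \<comment> \<open>For these members \<open>t\<close> cannot be the point of nonnegativity, so that
    point lies in \<open>S\<close> and the induction hypothesis applies.\<close>
  define C1 where "C1 = {c \<in> C. c t < 0}"
  have "\<exists>q. set_pmf q \<subseteq> S \<and> (\<forall>c\<in>C1. 0 \<le> (\<Sum>s\<in>S. pmf q s * c s))"
  proof (rule insert.IH)
    fix c d and \<alpha> :: real
    assume c: "c \<in> C1" "d \<in> C1" and \<alpha>: "0 \<le> \<alpha>" "\<alpha> \<le> 1"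
    have "(1 - \<alpha>) * c t + \<alpha> * d t < 0"
      using c \<alpha> by (intro convex_bound_lt) (auto simp: C1_def)
    with c \<alpha> show "(\<lambda>s. (1 - \<alpha>) * c s + \<alpha> * d s) \<in> C1"
      by (auto simp: C1_def intro: insert.prems)
  next
    fix c assume "c \<in> C1"
    then show "\<exists>s\<in>S. 0 \<le> c s"
      using insert.prems(2)[of c] by (auto simp: C1_def)
  qed
  then obtain q where q: "set_pmf q \<subseteq> S" and q_C1: "\<And>c. c \<in> C1 \<Longrightarrow> 0 \<le> (\<Sum>s\<in>S. pmf q s * c s)"
    by blast
  let ?E = "\<lambda>c. \<Sum>s\<in>S. pmf q s * c s"
  \<comment> \<open>Evaluation at \<open>t\<close> and expectation under \<open>q\<close> are both
    linear, so the planar image inherits convexity. It misses the negative quadrant because a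
    negative first coordinate puts \<open>c\<close> in \<open>C1\<close>, where the second is
    nonnegative.\<close>
  have "convex ((\<lambda>c. (c t, ?E c)) ` C)"
  proof (rule convexI)
    fix y z and u v :: real
    assume "y \<in> (\<lambda>c. (c t, ?E c)) ` C" "z \<in> (\<lambda>c. (c t, ?E c)) ` C"
      and uv: "0 \<le> u" "0 \<le> v" "u + v = 1"
    then obtain c d where cd: "c \<in> C" "d \<in> C" "y = (c t, ?E c)" "z = (d t, ?E d)"
      by blast
    have u: "u = 1 - v" using uv by simp
    have "(\<lambda>s. (1 - v) * c s + v * d s) \<in> C"
      using cd uv by (intro insert.prems) auto
    then show "u *\<^sub>R y + v *\<^sub>R z \<in> (\<lambda>c. (c t, ?E c)) ` C"
      by (rule rev_image_eqI)
        (simp add: cd u sum_distrib_left sum.distrib algebra_simps sum_subtractf)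
  qed
  moreover have "0 \<le> x \<or> 0 \<le> y" if "(x, y) \<in> (\<lambda>c. (c t, ?E c)) ` C" for x y
  proof -
    from that obtain c where c: "c \<in> C" "x = c t" "y = ?E c" by blast
    then show ?thesis using q_C1[of c] by (cases "c t < 0") (auto simp: C1_def)
  qed
  ultimately obtain \<alpha> where \<alpha>: "0 \<le> \<alpha>" "\<alpha> \<le> 1"
    and \<alpha>_C: "\<And>c. c \<in> C \<Longrightarrow> 0 \<le> (1 - \<alpha>) * c t + \<alpha> * ?E c"
    using convex_meets_no_negative_quadrant[of "(\<lambda>c. (c t, ?E c)) ` C"] by auto
  let ?q = "mix_pmf \<alpha> (return_pmf t) q"
  show ?case
  proof (intro exI[of _ ?q] conjI ballI)
    show "set_pmf ?q \<subseteq> insert t S"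
      using set_pmf_mix_pmf[of \<alpha> "return_pmf t" q] q by auto
    fix c assume "c \<in> C"
    \<comment> \<open>Hence the mixture has mass exactly \<open>1 - \<alpha>\<close> at
      \<open>t\<close> and \<alpha> times that of \<open>q\<close> on \<open>S\<close>, which
      reproduces the planar inequality.\<close>
    have "pmf q t = 0"
      using q insert.hyps by (auto simp: set_pmf_iff)
    then have "(\<Sum>s\<in>insert t S. pmf ?q s * c s) = (1 - \<alpha>) * c t + (\<Sum>s\<in>S. pmf ?q s * c s)"
      using insert.hyps \<alpha> by (simp add: pmf_mix_pmf)
    also have "(\<Sum>s\<in>S. pmf ?q s * c s) = \<alpha> * ?E c"
      unfolding sum_distrib_left using insert.hyps \<alpha>
      by (intro sum.cong) (auto simp: pmf_mix_pmf indicator_def)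
    finally show "0 \<le> (\<Sum>s\<in>insert t S. pmf ?q s * c s)"
      using \<alpha>_C[OF \<open>c \<in> C\<close>] by simp
  qed
qed

section \<open>Random losses and their dependence on one player's strategy\<close>

lemma finite_type_profiles: "game_form G \<Longrightarrow> finite (type_profiles G)"
  by (auto simp: game_form_def type_profiles_def players_def intro!: finite_PiE)

lemma type_profiles_nonempty: "game_form G \<Longrightarrow> type_profiles G \<noteq> {}"
  by (auto simp: game_form_def type_profiles_def PiE_eq_empty_iff)

text \<open>On a finite discrete space all functions are measurable, and the maximum of
  \<open>\<bar>X x\<bar>\<close> is a bound. This discharges the membership premises in
  \<open>coherent_risk_measure\<close>.\<close>

lemma L_infinity_eq_UNIV:
  assumes "finite (space M)" "sets M = Pow (space M)"
  shows "L_infinity M = UNIV"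
proof -
  have "AE x in M. \<bar>X x\<bar> \<le> Max ((\<lambda>x. \<bar>X x\<bar>) ` space M)" for X :: "'a \<Rightarrow> real"
    using assms(1) by (intro AE_I2 Max_ge) auto
  then show ?thesis
    using assms(2) by (fastforce simp: L_infinity_def measurable_def)
qed

text \<open>Splitting off the factor of player \<open>i\<close> makes the linearity in that player's
  own probabilities visible.\<close>

lemma random_loss_upd:
  assumes "i \<in> players G"
  shows "random_loss G i (\<beta>(i := \<beta>')) t =
    (\<Sum>a\<in>action_profiles G. loss G i t a *
       (pmf (\<beta>' (t i)) (a i) * (\<Prod>j\<in>players G - {i}. pmf (\<beta> j (t j)) (a j))))"
proof -
  have "finite (players G)" by (simp add: players_def)
  moreover have "(\<Prod>j\<in>players G - {i}. pmf ((\<beta>(i := \<beta>')) j (t j)) (a j)) =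
      (\<Prod>j\<in>players G - {i}. pmf (\<beta> j (t j)) (a j))" for a
    by (rule prod.cong) auto
  ultimately show ?thesis
    unfolding random_loss_def using assms
    by (simp add: prod.remove[of "players G" i] del: fun_upd_apply)
      simp
qed

text \<open>At \<open>t\<close> the loss sees only the value of \<gamma> at \<open>t i\<close>, so
  the mixture is assumed there alone; this admits a \<gamma> restricted to the type set.\<close>

lemma random_loss_mix:
  assumes i: "i \<in> players G" and \<alpha>: "0 \<le> \<alpha>" "\<alpha> \<le> 1"
    and mix: "\<gamma> (t i) = mix_pmf \<alpha> (\<beta>1 (t i)) (\<beta>2 (t i))"
  shows "random_loss G i (\<beta>(i := \<gamma>)) t =
    (1 - \<alpha>) * random_loss G i (\<beta>(i := \<beta>1)) t + \<alpha> * random_loss G i (\<beta>(i := \<beta>2)) t"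
  unfolding random_loss_upd[OF i] mix pmf_mix_pmf[OF \<alpha>]
  unfolding sum_distrib_left sum.distrib[symmetric]
  by (rule sum.cong) (simp_all add: algebra_simps)

text \<open>Restricting to \<open>types G i\<close> keeps the mixture extensional, as membership in
  \<open>PiE\<close> demands.\<close>

lemma mix_strategy:
  assumes "\<beta>1 \<in> strategies G i" "\<beta>2 \<in> strategies G i"
  shows "(\<lambda>s\<in>types G i. mix_pmf \<alpha> (\<beta>1 s) (\<beta>2 s)) \<in> strategies G i"
  using assms set_pmf_mix_pmf by (fastforce simp: strategies_def prob_simplex_def PiE_iff)

text \<open>The intended \<open>f\<close> is \<open>random_loss G i \<beta>\<close>; keeping it
  arbitrary avoids rewriting \<beta> as an update of itself.\<close>

lemma supporting_prior:
  assumes G: "game_form G" and P: "common_prior G P" and i: "i \<in> players G"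
    and \<rho>: "coherent_risk_measure P \<rho>"
    and f: "\<And>\<beta>'. \<beta>' \<in> strategies G i \<Longrightarrow> \<rho> f \<le> \<rho> (random_loss G i (\<beta>(i := \<beta>')))"
  shows "\<exists>q \<in> prob_simplex (type_profiles G). \<forall>\<beta>'\<in>strategies G i.
    (\<Sum>t\<in>type_profiles G. pmf q t * f t) \<le>
    (\<Sum>t\<in>type_profiles G. pmf q t * random_loss G i (\<beta>(i := \<beta>')) t)"
proof -
  let ?T = "type_profiles G"
  let ?L = "\<lambda>\<beta>'. random_loss G i (\<beta>(i := \<beta>'))"
  have space: "space P = ?T" and sets: "sets P = Pow ?T"
    using P by (auto simp: common_prior_def)
  have UNIV: "L_infinity P = UNIV"
    using finite_type_profiles[OF G] space sets by (simp add: L_infinity_eq_UNIV)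
  have mono: "\<rho> X \<le> \<rho> Y" if "\<And>t. t \<in> ?T \<Longrightarrow> X t \<le> Y t" for X Y
  proof -
    have "AE t in P. X t \<le> Y t"
      using that by (intro AE_I2) (simp add: space)
    then show ?thesis using \<rho> by (simp add: coherent_risk_measure_def UNIV)
  qed
  have conv: "\<rho> (\<lambda>x. (1 - \<alpha>) * X x + \<alpha> * Y x) \<le> (1 - \<alpha>) * \<rho> X + \<alpha> * \<rho> Y"
    if "0 \<le> \<alpha>" "\<alpha> \<le> 1" for X Y \<alpha>
    using \<rho> that by (simp add: coherent_risk_measure_def UNIV)
  have trans: "\<rho> (\<lambda>x. X x + c) = \<rho> X + c" for X c
    using \<rho> by (simp add: coherent_risk_measure_def UNIV)
  \<comment> \<open>This is \<open>K - D\<close>. The difference is prescribed only on type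
    profiles, since the restricted mixture of two strategies gives the mixed loss only
    there.\<close>
  define C where
    "C = {c. \<exists>\<beta>'\<in>strategies G i. \<exists>d. \<rho> d < \<rho> f \<and> (\<forall>t\<in>?T. c t = ?L \<beta>' t - d t)}"
  have "\<exists>q. set_pmf q \<subseteq> ?T \<and> (\<forall>c\<in>C. 0 \<le> (\<Sum>t\<in>?T. pmf q t * c t))"
  proof (rule convex_nonneg_expectation)
    fix c1 c2 and \<alpha> :: real
    assume c: "c1 \<in> C" "c2 \<in> C" and \<alpha>: "0 \<le> \<alpha>" "\<alpha> \<le> 1"
    from c(1) obtain \<beta>1 d1 where 1: "\<beta>1 \<in> strategies G i" "\<rho> d1 < \<rho> f"
        "\<And>t. t \<in> ?T \<Longrightarrow> c1 t = ?L \<beta>1 t - d1 t"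
      by (auto simp: C_def)
    from c(2) obtain \<beta>2 d2 where 2: "\<beta>2 \<in> strategies G i" "\<rho> d2 < \<rho> f"
        "\<And>t. t \<in> ?T \<Longrightarrow> c2 t = ?L \<beta>2 t - d2 t"
      by (auto simp: C_def)
    let ?\<gamma> = "\<lambda>s\<in>types G i. mix_pmf \<alpha> (\<beta>1 s) (\<beta>2 s)"
    let ?d = "\<lambda>t. (1 - \<alpha>) * d1 t + \<alpha> * d2 t"
    have "(1 - \<alpha>) * \<rho> d1 + \<alpha> * \<rho> d2 < \<rho> f"
      using \<alpha> 1 2 by (intro convex_bound_lt) auto
    then have "\<rho> ?d < \<rho> f"
      using conv[OF \<alpha>, of d1 d2] by simp
    moreover have "(1 - \<alpha>) * c1 t + \<alpha> * c2 t = ?L ?\<gamma> t - ?d t" if t: "t \<in> ?T" for t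
    proof -
      have "t i \<in> types G i"
        using t i by (auto simp: type_profiles_def)
      then have "?L ?\<gamma> t = (1 - \<alpha>) * ?L \<beta>1 t + \<alpha> * ?L \<beta>2 t"
        by (intro random_loss_mix i \<alpha>) simp
      then show ?thesis
        unfolding 1(3)[OF t] 2(3)[OF t] by (simp add: algebra_simps)
    qed
    ultimately show "(\<lambda>t. (1 - \<alpha>) * c1 t + \<alpha> * c2 t) \<in> C"
      unfolding C_def using mix_strategy[OF 1(1) 2(1), of \<alpha>]
      by (intro CollectI bexI[of _ ?\<gamma>] exI[of _ ?d]) auto
  next
    fix c assume "c \<in> C"
    then obtain \<beta>' d where d: "\<beta>' \<in> strategies G i" "\<rho> d < \<rho> f"
        "\<And>t. t \<in> ?T \<Longrightarrow> c t = ?L \<beta>' t - d t"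
      by (auto simp: C_def)
    show "\<exists>t\<in>?T. 0 \<le> c t"
    proof (rule ccontr)
      assume "\<not> (\<exists>t\<in>?T. 0 \<le> c t)"
      \<comment> \<open>If \<open>c\<close> is negative on all type profiles, the loss lies below
        \<open>d\<close> there, so its risk is below that of \<open>f\<close>, against
        minimality.\<close>
      then have "\<rho> (?L \<beta>') \<le> \<rho> d"
        using d(3) by (intro mono) force
      then show False using f[OF d(1)] d(2) by simp
    qed
  qed (use G finite_type_profiles type_profiles_nonempty in auto)
  then obtain q where q: "set_pmf q \<subseteq> ?T" and q_C: "\<And>c. c \<in> C \<Longrightarrow> 0 \<le> (\<Sum>t\<in>?T. pmf q t * c t)"
    by blast
  have "(\<Sum>t\<in>?T. pmf q t * f t) \<le> (\<Sum>t\<in>?T. pmf q t * ?L \<beta>' t)" if "\<beta>' \<in> strategies G i" for \<beta>'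
  proof (rule field_le_epsilon)
    fix e :: real assume "0 < e"
    \<comment> \<open>The strict inequality defining \<open>D\<close> excludes \<open>f\<close>
      itself; by translation invariance the shift by \<open>- e\<close> lowers the risk by exactly
      \<open>e\<close>. As \<open>q\<close> has total mass 1, the shift costs \<open>e\<close> in
      expectation, and \<open>e\<close> is arbitrary.\<close>
    let ?c = "\<lambda>t. ?L \<beta>' t - (f t + - e)"
    have "\<rho> (\<lambda>t. f t + - e) < \<rho> f"
      unfolding trans using \<open>0 < e\<close> by simp
    then have "?c \<in> C"
      unfolding C_def using that by blast
    then have "0 \<le> (\<Sum>t\<in>?T. pmf q t * ?c t)"
      by (rule q_C)
    also have "\<dots> = (\<Sum>t\<in>?T. pmf q t * ?L \<beta>' t) - (\<Sum>t\<in>?T. pmf q t * f t) + e * (\<Sum>t\<in>?T. pmf q t)"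
      by (simp add: algebra_simps sum.distrib sum_subtractf sum_distrib_left)
    also have "(\<Sum>t\<in>?T. pmf q t) = 1"
      using q finite_type_profiles[OF G] by (rule sum_pmf_eq_1[rotated])
    finally show "(\<Sum>t\<in>?T. pmf q t * f t) \<le> (\<Sum>t\<in>?T. pmf q t * ?L \<beta>' t) + e"
      by (simp del: fun_upd_apply)
  qed
  with q show ?thesis
    by (auto simp: prob_simplex_def)
qed

theorem proposition2:
  fixes G :: "('t, 'a) game"
    and P :: "(nat \<Rightarrow> 't) measure"
    and \<rho> :: "nat \<Rightarrow> ((nat \<Rightarrow> 't) \<Rightarrow> real) \<Rightarrow> real"
    and \<beta> :: "nat \<Rightarrow> 't \<Rightarrow> 'a pmf"
  assumes "game_form G"
    and "common_prior G P"
    and "\<And>i. i \<in> players G \<Longrightarrow> coherent_risk_measure P (\<rho> i)"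
    and "\<And>i. i \<in> players G \<Longrightarrow> law_invariant P (\<rho> i)"
    and "\<beta> \<in> NE_ea G \<rho>"
  shows "\<exists>q :: nat \<Rightarrow> (nat \<Rightarrow> 't) pmf.
           (\<forall>i\<in>players G. q i \<in> prob_simplex (type_profiles G)) \<and> \<beta> \<in> NE_ea_neutral G q"
proof -
  have \<beta>: "\<beta> \<in> strategy_profiles G"
    and min: "\<And>i \<beta>'. i \<in> players G \<Longrightarrow> \<beta>' \<in> strategies G i \<Longrightarrow>
      \<rho> i (random_loss G i \<beta>) \<le> \<rho> i (random_loss G i (\<beta>(i := \<beta>')))"
    using assms(5) by (auto simp: NE_ea_def)
  let ?supports = "\<lambda>i q. \<forall>\<beta>'\<in>strategies G i.
    (\<Sum>t\<in>type_profiles G. pmf q t * random_loss G i \<beta> t) \<le>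
    (\<Sum>t\<in>type_profiles G. pmf q t * random_loss G i (\<beta>(i := \<beta>')) t)"
  have "\<exists>q. q \<in> prob_simplex (type_profiles G) \<and> ?supports i q" if i: "i \<in> players G" for i
    using supporting_prior[OF assms(1,2) i assms(3)[OF i] min[OF i]] by blast
  then have "\<forall>i\<in>players G. \<exists>q. q \<in> prob_simplex (type_profiles G) \<and> ?supports i q"
    by (rule ballI)
  \<comment> \<open>The priors are found player by player and may differ; values of \<open>q\<close>
    outside \<open>players G\<close> are irrelevant to \<open>NE_ea_neutral\<close>.\<close>
  from bchoice[OF this] obtain q where
    "\<forall>i\<in>players G. q i \<in> prob_simplex (type_profiles G) \<and> ?supports i (q i)" ..
  with \<beta> show ?thesis
    by (intro exI[of _ q]) (simp add: NE_ea_neutral_def)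
qed

end
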